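(* Let $\alpha=(\alpha_\top,\alpha_\perp)\colon f_A\to f_B$ be a double extension of racks (or in particular of quandles), with $f_A\colon A_\top\to A_\perp$ and $f_B\colon B_\top\to B_\perp$. Then the morphism $\bar\alpha\colon\mathrm C_1(f_A)\to\mathrm C_1(f_B)$ induced by $\alpha_\top$ between the centralizing relations is a regular epimorphism (i.e. surjective). Moreover, if $f_A$ is a central extension then $f_B$ is a central extension.
   Context: A rack is a set $X$ with two binary operations $\triangleleft,\triangleleft^{-1}$ such that $(x\triangleleft y)\triangleleft^{-1}y = x = (x\triangleleft^{-1}y)\triangleleft y$ and $(x\triangleleft y)\triangleleft z=(x\triangleleft z)\triangleleft(y\triangleleft z)$; a quandle is a rack with $x\triangleleft x=x$. An extension is a surjective morphism. A morphism $\alpha=(\alpha_\top,\alpha_\perp)\colon f_A\to f_B$ of extensions is a pair of morphisms $\alpha_\top\colon A_\top\to B_\top$, $\alpha_\perp\colon A_\perp\to B_\perp$ with $f_B\alpha_\top=\alpha_\perp f_A$. It is a double extension if $\alpha_\top$, $\alpha_\perp$ and the comparison map $p\colon A_\top\to A_\perp\times_{B_\perp}B_\top$ are all surjective. For an extension $f\colon A\to B$, the centralizing relation $\mathrm C_1(f)$ is the equivalence relation on $A$ generated by the pairs $\big((x\triangleleft a)\triangleleft^{-1}b,x\big)$ with $x,a,b\in A$ and $f(a)=f(b)$; it is a congruence, regarded as a subrack of $A\times A$. $\pi_0(X)$ is the quotient of the set $X$ by the equivalence relation generated by the pairs $(x,x\triangleleft y)$, with quotient map $\eta_X$. An extension $t\colon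 X\to Y$ is trivial if the square $\eta_Yt=\pi_0(t)\eta_X$ is a pullback (sets being viewed as racks with $x\triangleleft y=x$). An extension $f\colon A\to B$ is central if its pullback along some extension $E\to B$ is trivial; equivalently, if $(x\triangleleft a)\triangleleft^{-1}b=x$ for all $x,a,b\in A$ with $f(a)=f(b)$. *)

theory Defs
  imports Main
begin

record 'a rack_str =
  carrier :: "'a set"
  act :: "'a \<Rightarrow> 'a \<Rightarrow> 'a" (infixl "\<triangleleft>\<index>" 70)
  inv_act :: "'a \<Rightarrow> 'a \<Rightarrow> 'a" (infixl "\<triangleleft>\<inverse>\<index>" 70)

locale rack =
  fixes X :: "'a rack_str" (structure)
  assumes act_closed: "\<lbrakk>x \<in> carrier X; y \<in> carrier X\<rbrakk> \<Longrightarrow> x \<triangleleft> y \<in> carrier X"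
    and inv_act_closed: "\<lbrakk>x \<in> carrier X; y \<in> carrier X\<rbrakk> \<Longrightarrow> x \<triangleleft>\<inverse> y \<in> carrier X"
    and act_inv_act: "\<lbrakk>x \<in> carrier X; y \<in> carrier X\<rbrakk> \<Longrightarrow> (x \<triangleleft> y) \<triangleleft>\<inverse> y = x"
    and inv_act_act: "\<lbrakk>x \<in> carrier X; y \<in> carrier X\<rbrakk> \<Longrightarrow> (x \<triangleleft>\<inverse> y) \<triangleleft> y = x"
    and self_distrib: "\<lbrakk>x \<in> carrier X; y \<in> carrier X; z \<in> carrier X\<rbrakk>
      \<Longrightarrow> (x \<triangleleft> y) \<triangleleft> z = (x \<triangleleft> z) \<triangleleft> (y \<triangleleft> z)"

locale quandle = rack +
  assumes idem: "x \<in> carrier X \<Longrightarrow> x \<triangleleft> x = x"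

text \<open>Maps between racks are total functions of which only the values on the carrier matter.\<close>

definition rack_hom :: "'a rack_str \<Rightarrow> 'b rack_str \<Rightarrow> ('a \<Rightarrow> 'b) \<Rightarrow> bool" where
  "rack_hom X Y f \<longleftrightarrow>
     (\<forall>x\<in>carrier X. f x \<in> carrier Y) \<and>
     (\<forall>x\<in>carrier X. \<forall>y\<in>carrier X.
        f (x \<triangleleft>\<^bsub>X\<^esub> y) = f x \<triangleleft>\<^bsub>Y\<^esub> f y \<and> f (x \<triangleleft>\<inverse>\<^bsub>X\<^esub> y) = f x \<triangleleft>\<inverse>\<^bsub>Y\<^esub> f y)"

definition rack_iso :: "'a rack_str \<Rightarrow> 'b rack_str \<Rightarrow> ('a \<Rightarrow> 'b) \<Rightarrow> bool" where
  "rack_iso X Y f \<longleftrightarrow> rack_hom X Y f \<and> bij_betw f (carrier X) (carrier Y)"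

definition extension :: "'a rack_str \<Rightarrow> 'b rack_str \<Rightarrow> ('a \<Rightarrow> 'b) \<Rightarrow> bool" where
  "extension A B f \<longleftrightarrow> rack A \<and> rack B \<and> rack_hom A B f \<and> f ` carrier A = carrier B"

definition subrack_prod :: "'a rack_str \<Rightarrow> 'b rack_str \<Rightarrow> ('a \<times> 'b) set \<Rightarrow> ('a \<times> 'b) rack_str" where
  "subrack_prod X Y R =
     \<lparr>carrier = R,
      act = (\<lambda>(x, y) (x', y'). (x \<triangleleft>\<^bsub>X\<^esub> x', y \<triangleleft>\<^bsub>Y\<^esub> y')),
      inv_act = (\<lambda>(x, y) (x', y'). (x \<triangleleft>\<inverse>\<^bsub>X\<^esub> x', y \<triangleleft>\<inverse>\<^bsub>Y\<^esub> y'))\<rparr>"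

definition pullback :: "'a rack_str \<Rightarrow> 'b rack_str \<Rightarrow> ('a \<Rightarrow> 'c) \<Rightarrow> ('b \<Rightarrow> 'c) \<Rightarrow> ('a \<times> 'b) rack_str" where
  "pullback X Y f g = subrack_prod X Y {(x, y). x \<in> carrier X \<and> y \<in> carrier Y \<and> f x = g y}"

definition double_extension ::
  "'a rack_str \<Rightarrow> 'b rack_str \<Rightarrow> ('a \<Rightarrow> 'b) \<Rightarrow> 'c rack_str \<Rightarrow> 'd rack_str \<Rightarrow> ('c \<Rightarrow> 'd)
    \<Rightarrow> ('a \<Rightarrow> 'c) \<Rightarrow> ('b \<Rightarrow> 'd) \<Rightarrow> bool" where
  "double_extension A_top A_bot f_A B_top B_bot f_B \<alpha>_top \<alpha>_bot \<longleftrightarrow>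
     extension A_top A_bot f_A \<and> extension B_top B_bot f_B \<and>
     extension A_top B_top \<alpha>_top \<and> extension A_bot B_bot \<alpha>_bot \<and>
     (\<forall>x\<in>carrier A_top. f_B (\<alpha>_top x) = \<alpha>_bot (f_A x)) \<and>
     (\<lambda>x. (f_A x, \<alpha>_top x)) ` carrier A_top = carrier (pullback A_bot B_top \<alpha>_bot f_B)"

definition generated_equiv :: "'a set \<Rightarrow> 'a rel \<Rightarrow> 'a rel" where
  "generated_equiv S r = \<Inter>{R. equiv S R \<and> r \<subseteq> R}"

definition centralizing_rel :: "'a rack_str \<Rightarrow> ('a \<Rightarrow> 'b) \<Rightarrow> 'a rel" where
  "centralizing_rel A f = generated_equiv (carrier A)
     {((x \<triangleleft>\<^bsub>A\<^esub> a) \<triangleleft>\<inverse>\<^bsub>A\<^esub> b, x) | x a b.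
        x \<in> carrier A \<and> a \<in> carrier A \<and> b \<in> carrier A \<and> f a = f b}"

definition centralizing_rack :: "'a rack_str \<Rightarrow> ('a \<Rightarrow> 'b) \<Rightarrow> ('a \<times> 'a) rack_str" where
  "centralizing_rack A f = subrack_prod A A (centralizing_rel A f)"

definition orbit_rel :: "'a rack_str \<Rightarrow> 'a rel" where
  "orbit_rel X = generated_equiv (carrier X)
     {(x, x \<triangleleft>\<^bsub>X\<^esub> y) | x y. x \<in> carrier X \<and> y \<in> carrier X}"

definition trivial_rack :: "'a set \<Rightarrow> 'a rack_str" where
  "trivial_rack S = \<lparr>carrier = S, act = (\<lambda>x y. x), inv_act = (\<lambda>x y. x)\<rparr>"

definition pi0 :: "'a rack_str \<Rightarrow> 'a set rack_str" where
  "pi0 X = trivial_rack (carrier X // orbit_rel X)"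

definition pi0_unit :: "'a rack_str \<Rightarrow> 'a \<Rightarrow> 'a set" where
  "pi0_unit X x = orbit_rel X `` {x}"

text \<open>A morphism \<open>t\<close> into \<open>Y\<close> sends an orbit \<open>c\<close> to the orbit of \<open>Y\<close> containing \<open>t ` c\<close>.\<close>

definition pi0_map :: "'b rack_str \<Rightarrow> ('a \<Rightarrow> 'b) \<Rightarrow> 'a set \<Rightarrow> 'b set" where
  "pi0_map Y t c = orbit_rel Y `` (t ` c)"

text \<open>The naturality square of \<open>pi0_unit\<close> at \<open>t\<close> is a pullback iff the comparison morphism into
  the canonical pullback is an isomorphism.\<close>

definition trivial_extension :: "'a rack_str \<Rightarrow> 'b rack_str \<Rightarrow> ('a \<Rightarrow> 'b) \<Rightarrow> bool" where
  "trivial_extension X Y t \<longleftrightarrow> extension X Y t \<and>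
     rack_iso X (pullback Y (pi0 X) (pi0_unit Y) (pi0_map Y t)) (\<lambda>x. (t x, pi0_unit X x))"

text \<open>The predicate \<open>K\<close> is \<open>rack\<close> or \<open>quandle\<close>, according to the category in which the splitting
  extension \<open>E \<rightarrow> B\<close> is sought. Since HOL cannot quantify over types inside a definition, the type
  of the elements of \<open>E\<close> is fixed by the type at which \<open>K\<close> is instantiated.\<close>

definition central_extension ::
  "('e rack_str \<Rightarrow> bool) \<Rightarrow> 'a rack_str \<Rightarrow> 'b rack_str \<Rightarrow> ('a \<Rightarrow> 'b) \<Rightarrow> bool" where
  "central_extension K A B f \<longleftrightarrow> extension A B f \<and>
     (\<exists>E p. K E \<and> extension E B p \<and> trivial_extension (pullback E A p f) E fst)"

text \<open>The free rack on a set \<open>S\<close> is \<open>S \<times> F\<close> with \<open>F\<close> the free group on \<open>S\<close>, whose elements are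
  represented by words in signed letters. By projectivity, if some extension of a rack with elements
  in \<open>'a\<close> splits a given one, then so does one whose elements are in this type; likewise for
  quandles, the free quandle being a quotient of the free rack.\<close>

type_synonym 'a free_rack_elt = "'a \<times> ('a \<times> bool) list"

end

theory Submission
  imports Defs
begin

text \<open>Surjectivity between the centralizing relations is a matter of lifting chains of generating
  pairs. Surjectivity of the comparison map to the pullback says that a pair \<open>a, b\<close> with
  \<open>f_B a = f_B b\<close> lifts to a pair with equal image under \<open>f_A\<close>
  (\<open>lift_kernel_pair\<close>). Such a pair can act on any prescribed lift of a point \<open>x\<close>, so each generating
  pair of the relation downstairs lifts with a prescribed starting point, and a whole chain lifts by
  starting each link where the previous one ended (\<open>generated_equiv_lift\<close>).

  For centrality, the intermediate notion is the equational one: the action of \<open>a\<close> depends only on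
  \<open>f a\<close>. Centrality implies it (\<open>central_extension_acts_through\<close>), and it passes from \<open>f_A\<close> to
  \<open>f_B\<close> because configurations of elements lift (\<open>acts_through_image\<close>). It remains to split an
  extension \<open>f : A \<rightarrow> B\<close> satisfying the equational condition. Under this condition \<open>B\<close> acts on \<open>A\<close>,
  and every word \<open>w\<close> in the translations by elements of \<open>B\<close> transports the fibre over \<open>s\<close>
  bijectively to the fibre over \<open>s \<cdot> w\<close>. Let \<open>E\<close> consist of the pairs of a starting point \<open>s\<close> and a
  word \<open>w\<close>, where two words are identified if they induce the same transport on the fibre over \<open>s\<close>;
  an element acts on \<open>(s, w)\<close> by appending its own endpoint to \<open>w\<close>. Then \<open>E \<rightarrow> B\<close>,
  \<open>(s, w) \<mapsto> s \<cdot> w\<close>, is an extension, and in the pullback of \<open>f\<close> along it the point \<open>((s, w), x)\<close>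
  has an invariant, namely the point of the fibre over \<open>s\<close> which \<open>w\<close> transports to \<open>x\<close>. The
  invariant is constant on orbits and determines \<open>x\<close> once \<open>(s, w)\<close> is given, which is what triviality
  of the pullback requires. This \<open>E\<close> is the quotient of the free rack on \<open>B\<close> by exactly those
  identifications that transport cannot see, so it is a quandle as soon as \<open>A\<close> is one, and the same
  construction serves racks and quandles.\<close>

section \<open>Generated equivalence relations\<close>

lemma equiv_symD: "equiv S R \<Longrightarrow> (x, y) \<in> R \<Longrightarrow> (y, x) \<in> R"
  by (auto simp: equiv_def dest: symD)

lemma equiv_transD: "equiv S R \<Longrightarrow> (x, y) \<in> R \<Longrightarrow> (y, z) \<in> R \<Longrightarrow> (x, z) \<in> R"
  by (auto simp: equiv_def dest: transD)

lemma equiv_generated_equiv: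
  assumes "r \<subseteq> S \<times> S"
  shows "equiv S (generated_equiv S r)"
proof -
  have "equiv S (S \<times> S)"
    by (auto intro!: equivI refl_onI symI transI)
  then have sub: "generated_equiv S r \<subseteq> S \<times> S"
    unfolding generated_equiv_def using assms by blast
  have "refl_on S (generated_equiv S r)"
    unfolding generated_equiv_def by (auto intro!: refl_onI simp: equiv_def refl_on_def)
  moreover have "sym (generated_equiv S r)"
    unfolding generated_equiv_def by (auto intro!: symI simp: equiv_def dest: symD)
  moreover have "trans (generated_equiv S r)"
    unfolding generated_equiv_def
    by (rule transI) (auto simp: equiv_def elim: transE)
  ultimately show ?thesis using sub by (intro equivI) auto
qed

lemma generated_equiv_incl: "r \<subseteq> generated_equiv S r"
  unfolding generated_equiv_def by blast

lemma generated_equiv_least: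
  assumes "equiv S R" "r \<subseteq> R"
  shows "generated_equiv S r \<subseteq> R"
  using assms unfolding generated_equiv_def by blast

text \<open>The preimage of an equivalence relation under \<open>t\<close> is an equivalence relation, so it suffices to
  test generators. With equality for \<open>Q\<close> this says that a function invariant along
  generators is an invariant of the classes.\<close>

lemma generated_equiv_map:
  assumes Q: "equiv T Q" and xy: "(x, y) \<in> generated_equiv S r"
    and t: "\<And>x. x \<in> S \<Longrightarrow> t x \<in> T" and r: "r \<subseteq> S \<times> S"
    and step: "\<And>x y. (x, y) \<in> r \<Longrightarrow> (t x, t y) \<in> Q"
  shows "(t x, t y) \<in> Q"
proof -
  let ?R = "{(x, y). x \<in> S \<and> y \<in> S \<and> (t x, t y) \<in> Q}"
  have "equiv S ?R"
    using Q t
    by (intro equivI refl_onI symI transI) (auto simp: equiv_def refl_on_def dest: symD transD)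
  moreover have "r \<subseteq> ?R" using r step by auto
  ultimately show ?thesis using generated_equiv_least xy by blast
qed

text \<open>Relations upstairs need not compose when their images downstairs do, because the
  endpoints to be joined may be different lifts of one point. Prescribing the lift of the starting
  point removes this obstacle: lifts of a chain of generators can then be joined one after the
  other.\<close>

lemma generated_equiv_lift:
  assumes Q: "equiv S Q" and uv: "(u, v) \<in> generated_equiv T r" and x: "x \<in> S" "t x = u"
    and r: "r \<subseteq> T \<times> T"
    and fwd: "\<And>u v x. (u, v) \<in> r \<Longrightarrow> x \<in> S \<Longrightarrow> t x = u \<Longrightarrow> \<exists>y. t y = v \<and> (x, y) \<in> Q"
    and bwd: "\<And>u v x. (u, v) \<in> r \<Longrightarrow> x \<in> S \<Longrightarrow> t x = v \<Longrightarrow> \<exists>y. t y = u \<and> (x, y) \<in> Q"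
  shows "\<exists>y. t y = v \<and> (x, y) \<in> Q"
proof -
  have QS: "Q \<subseteq> S \<times> S" using Q by (auto simp: equiv_def)
  let ?L = "\<lambda>u v. \<forall>x\<in>S. t x = u \<longrightarrow> (\<exists>y. t y = v \<and> (x, y) \<in> Q)"
  let ?R = "{(u, v). u \<in> T \<and> v \<in> T \<and> ?L u v \<and> ?L v u}"
  have refl: "?L u u" for u using Q by (auto simp: equiv_def refl_on_def)
  have trans: "?L u w" if uv: "?L u v" and vw: "?L v w" for u v w
  proof (intro ballI impI)
    fix x assume "x \<in> S" "t x = u"
    then obtain y where y: "t y = v" "(x, y) \<in> Q" using uv by blast
    then have "y \<in> S" using QS by blast
    then obtain z where "t z = w" "(y, z) \<in> Q" using vw y by blast
    then show "\<exists>z. t z = w \<and> (x, z) \<in> Q" using y equiv_transD[OF Q] by blast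
  qed
  have "equiv T ?R"
  proof (intro equivI refl_onI symI transI)
    show "?R \<subseteq> T \<times> T" by auto
  next
    fix u assume "u \<in> T" then show "(u, u) \<in> ?R" using refl by simp
  next
    fix u v assume "(u, v) \<in> ?R" then show "(v, u) \<in> ?R" by simp
  next
    fix u v w assume "(u, v) \<in> ?R" "(v, w) \<in> ?R"
    then show "(u, w) \<in> ?R" using trans[of u v w] trans[of w v u] by simp
  qed
  moreover have "r \<subseteq> ?R" using r fwd bwd by auto
  ultimately have "(u, v) \<in> ?R" using generated_equiv_least uv by blast
  then show ?thesis using x by blast
qed

section \<open>Racks, homomorphisms and pullbacks\<close>

context rack
begin

lemma act_right_cancel:
  assumes "x \<in> carrier X" "y \<in> carrier X" "a \<in> carrier X" "x \<triangleleft> a = y \<triangleleft> a"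
  shows "x = y"
  using assms act_inv_act by metis

lemma inv_act_act_distrib:
  assumes "x \<in> carrier X" "y \<in> carrier X" "z \<in> carrier X"
  shows "(x \<triangleleft>\<inverse> y) \<triangleleft> z = (x \<triangleleft> z) \<triangleleft>\<inverse> (y \<triangleleft> z)"
proof (rule act_right_cancel[of _ _ "y \<triangleleft> z"])
  show "(x \<triangleleft>\<inverse> y) \<triangleleft> z \<triangleleft> (y \<triangleleft> z) = (x \<triangleleft> z) \<triangleleft>\<inverse> (y \<triangleleft> z) \<triangleleft> (y \<triangleleft> z)"
    using assms self_distrib[of "x \<triangleleft>\<inverse> y" y z]
    by (simp add: act_closed inv_act_closed inv_act_act)
qed (simp_all add: assms act_closed inv_act_closed)

lemma act_inv_act_distrib:
  assumes "x \<in> carrier X" "y \<in> carrier X" "z \<in> carrier X"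
  shows "(x \<triangleleft> y) \<triangleleft>\<inverse> z = (x \<triangleleft>\<inverse> z) \<triangleleft> (y \<triangleleft>\<inverse> z)"
proof (rule act_right_cancel[of _ _ z])
  show "(x \<triangleleft> y) \<triangleleft>\<inverse> z \<triangleleft> z = (x \<triangleleft>\<inverse> z) \<triangleleft> (y \<triangleleft>\<inverse> z) \<triangleleft> z"
    using assms self_distrib[of "x \<triangleleft>\<inverse> z" "y \<triangleleft>\<inverse> z" z]
    by (simp add: act_closed inv_act_closed inv_act_act)
qed (simp_all add: assms act_closed inv_act_closed)

lemma inv_act_inv_act_distrib:
  assumes "x \<in> carrier X" "y \<in> carrier X" "z \<in> carrier X"
  shows "(x \<triangleleft>\<inverse> y) \<triangleleft>\<inverse> z = (x \<triangleleft>\<inverse> z) \<triangleleft>\<inverse> (y \<triangleleft>\<inverse> z)"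
proof (rule act_right_cancel[of _ _ z])
  show "(x \<triangleleft>\<inverse> y) \<triangleleft>\<inverse> z \<triangleleft> z = (x \<triangleleft>\<inverse> z) \<triangleleft>\<inverse> (y \<triangleleft>\<inverse> z) \<triangleleft> z"
    using assms inv_act_act_distrib[of "x \<triangleleft>\<inverse> z" "y \<triangleleft>\<inverse> z" z]
    by (simp add: act_closed inv_act_closed inv_act_act)
qed (simp_all add: assms act_closed inv_act_closed)

end

lemma rack_homD:
  assumes "rack_hom X Y f" "x \<in> carrier X"
  shows "f x \<in> carrier Y"
    and "y \<in> carrier X \<Longrightarrow> f (x \<triangleleft>\<^bsub>X\<^esub> y) = f x \<triangleleft>\<^bsub>Y\<^esub> f y"
    and "y \<in> carrier X \<Longrightarrow> f (x \<triangleleft>\<inverse>\<^bsub>X\<^esub> y) = f x \<triangleleft>\<inverse>\<^bsub>Y\<^esub> f y"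
  using assms by (auto simp: rack_hom_def)

lemma extensionD:
  assumes "extension A B f"
  shows "rack A" "rack B" "rack_hom A B f" "f ` carrier A = carrier B"
  using assms by (auto simp: extension_def)

lemma extension_lift:
  assumes "extension A B f" "y \<in> carrier B"
  obtains x where "x \<in> carrier A" "f x = y"
proof -
  have "y \<in> f ` carrier A" using assms by (simp add: extension_def)
  then show thesis using that by blast
qed

lemma subrack_prod_sel [simp]:
  "carrier (subrack_prod X Y R) = R"
  "(x, y) \<triangleleft>\<^bsub>subrack_prod X Y R\<^esub> (x', y') = (x \<triangleleft>\<^bsub>X\<^esub> x', y \<triangleleft>\<^bsub>Y\<^esub> y')"
  "(x, y) \<triangleleft>\<inverse>\<^bsub>subrack_prod X Y R\<^esub> (x', y') = (x \<triangleleft>\<inverse>\<^bsub>X\<^esub> x', y \<triangleleft>\<inverse>\<^bsub>Y\<^esub> y')"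
  by (simp_all add: subrack_prod_def)

lemma rack_subrack_prod:
  assumes X: "rack X" and Y: "rack Y" and R: "R \<subseteq> carrier X \<times> carrier Y"
    and act: "\<And>x y x' y'. (x, y) \<in> R \<Longrightarrow> (x', y') \<in> R \<Longrightarrow> (x \<triangleleft>\<^bsub>X\<^esub> x', y \<triangleleft>\<^bsub>Y\<^esub> y') \<in> R"
    and inv: "\<And>x y x' y'. (x, y) \<in> R \<Longrightarrow> (x', y') \<in> R \<Longrightarrow> (x \<triangleleft>\<inverse>\<^bsub>X\<^esub> x', y \<triangleleft>\<inverse>\<^bsub>Y\<^esub> y') \<in> R"
  shows "rack (subrack_prod X Y R)"
proof -
  interpret X: rack X by (fact X)
  interpret Y: rack Y by (fact Y)
  have mem: "x \<in> carrier X" "y \<in> carrier Y" if "(x, y) \<in> R" for x y using R that by auto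
  show ?thesis
  proof
    fix p q assume "p \<in> carrier (subrack_prod X Y R)" "q \<in> carrier (subrack_prod X Y R)"
    then obtain x y x' y' where p: "p = (x, y)" "(x, y) \<in> R" and q: "q = (x', y')" "(x', y') \<in> R"
      by (cases p, cases q) auto
    note mems = mem[OF p(2)] mem[OF q(2)]
    show "p \<triangleleft>\<^bsub>subrack_prod X Y R\<^esub> q \<in> carrier (subrack_prod X Y R)"
      "p \<triangleleft>\<inverse>\<^bsub>subrack_prod X Y R\<^esub> q \<in> carrier (subrack_prod X Y R)"
      using p q act inv by simp_all
    show "p \<triangleleft>\<^bsub>subrack_prod X Y R\<^esub> q \<triangleleft>\<inverse>\<^bsub>subrack_prod X Y R\<^esub> q = p"
      "p \<triangleleft>\<inverse>\<^bsub>subrack_prod X Y R\<^esub> q \<triangleleft>\<^bsub>subrack_prod X Y R\<^esub> q = p"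
      using p q mems by (simp_all add: X.act_inv_act X.inv_act_act Y.act_inv_act Y.inv_act_act)
    fix r assume "r \<in> carrier (subrack_prod X Y R)"
    then obtain x'' y'' where r: "r = (x'', y'')" "(x'', y'') \<in> R"
      by (cases r) auto
    show "p \<triangleleft>\<^bsub>subrack_prod X Y R\<^esub> q \<triangleleft>\<^bsub>subrack_prod X Y R\<^esub> r =
        p \<triangleleft>\<^bsub>subrack_prod X Y R\<^esub> r \<triangleleft>\<^bsub>subrack_prod X Y R\<^esub> (q \<triangleleft>\<^bsub>subrack_prod X Y R\<^esub> r)"
      using p q r mems mem[OF r(2)] X.self_distrib[of x x' x''] Y.self_distrib[of y y' y''] by simp
  qed
qed

lemma rack_pullback:
  assumes X: "rack X" and Y: "rack Y" and f: "rack_hom X Z f" and g: "rack_hom Y Z g"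
  shows "rack (pullback X Y f g)"
  unfolding pullback_def
  by (rule rack_subrack_prod[OF X Y])
    (auto simp: rack_homD[OF f] rack_homD[OF g] rack.act_closed[OF X] rack.act_closed[OF Y]
      rack.inv_act_closed[OF X] rack.inv_act_closed[OF Y])

lemma extension_pullback_fst:
  assumes p: "extension E B p" and f: "extension A B f"
  shows "extension (pullback E A p f) E fst"
proof -
  note p' = extensionD[OF p] and f' = extensionD[OF f]
  have "rack_hom (pullback E A p f) E fst"
    by (auto simp: rack_hom_def pullback_def)
  moreover have "carrier E \<subseteq> fst ` carrier (pullback E A p f)"
  proof
    fix e assume e: "e \<in> carrier E"
    then have "p e \<in> carrier B" using rack_homD(1)[OF p'(3)] by blast
    then obtain a where "a \<in> carrier A" "f a = p e" using extension_lift[OF f] by blast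
    then show "e \<in> fst ` carrier (pullback E A p f)"
      using e by (intro image_eqI[of _ _ "(e, a)"]) (auto simp: pullback_def)
  qed
  moreover have "fst ` carrier (pullback E A p f) \<subseteq> carrier E" by (auto simp: pullback_def)
  ultimately show ?thesis
    unfolding extension_def
    by (intro conjI equalityI rack_pullback[OF p'(1) f'(1) p'(3) f'(3)] p'(1))
qed

section \<open>The centralizing relation\<close>

abbreviation centralizing_pairs :: "'a rack_str \<Rightarrow> ('a \<Rightarrow> 'b) \<Rightarrow> 'a rel" where
  "centralizing_pairs A f \<equiv> {((x \<triangleleft>\<^bsub>A\<^esub> a) \<triangleleft>\<inverse>\<^bsub>A\<^esub> b, x) | x a b.
     x \<in> carrier A \<and> a \<in> carrier A \<and> b \<in> carrier A \<and> f a = f b}"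

lemma centralizing_pairs_subset:
  assumes "rack A"
  shows "centralizing_pairs A f \<subseteq> carrier A \<times> carrier A"
proof -
  interpret A: rack A by (fact assms)
  show ?thesis by (auto simp: A.act_closed A.inv_act_closed)
qed

lemma equiv_centralizing_rel:
  assumes "rack A"
  shows "equiv (carrier A) (centralizing_rel A f)"
  unfolding centralizing_rel_def by (intro equiv_generated_equiv centralizing_pairs_subset assms)

lemma centralizing_relI:
  assumes "x \<in> carrier A" "a \<in> carrier A" "b \<in> carrier A" "f a = f b"
  shows "((x \<triangleleft>\<^bsub>A\<^esub> a) \<triangleleft>\<inverse>\<^bsub>A\<^esub> b, x) \<in> centralizing_rel A f"
proof -
  have "((x \<triangleleft>\<^bsub>A\<^esub> a) \<triangleleft>\<inverse>\<^bsub>A\<^esub> b, x) \<in> centralizing_pairs A f"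
    unfolding mem_Collect_eq using assms by (intro exI[of _ x] exI[of _ a] exI[of _ b]) simp
  then show ?thesis unfolding centralizing_rel_def using generated_equiv_incl by (rule rev_subsetD)
qed

lemma centralizing_rel_kernel:
  assumes A: "rack A" and B: "rack B" and f: "rack_hom A B f"
    and "(x, y) \<in> centralizing_rel A f"
  shows "f x = f y"
proof -
  interpret A: rack A by (fact A)
  interpret B: rack B by (fact B)
  have "equiv (carrier B) (Id_on (carrier B))"
    by (auto intro!: equivI refl_onI symI transI)
  then have "(f x, f y) \<in> Id_on (carrier B)"
    using assms(4) unfolding centralizing_rel_def
    by (rule generated_equiv_map)
      (auto simp: rack_homD[OF f] A.act_closed A.inv_act_closed B.act_inv_act)
  then show ?thesis by auto
qed

text \<open>Both right translations are automorphisms of the rack, and they carry pairs with equal image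
  under \<open>f\<close> to such pairs.\<close>

lemma centralizing_rel_translate:
  assumes A: "rack A" and f: "rack_hom A B f"
    and c: "c \<in> carrier A" and xy: "(x, y) \<in> centralizing_rel A f"
  shows "(x \<triangleleft>\<^bsub>A\<^esub> c, y \<triangleleft>\<^bsub>A\<^esub> c) \<in> centralizing_rel A f"
    and "(x \<triangleleft>\<inverse>\<^bsub>A\<^esub> c, y \<triangleleft>\<inverse>\<^bsub>A\<^esub> c) \<in> centralizing_rel A f"
proof -
  interpret A: rack A by (fact A)
  show "(x \<triangleleft>\<^bsub>A\<^esub> c, y \<triangleleft>\<^bsub>A\<^esub> c) \<in> centralizing_rel A f"
  proof (rule generated_equiv_map[where t = "\<lambda>x. x \<triangleleft>\<^bsub>A\<^esub> c",
        OF equiv_centralizing_rel[OF A] xy[unfolded centralizing_rel_def] _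
          centralizing_pairs_subset[OF A]])
    fix x y assume "(x, y) \<in> centralizing_pairs A f"
    then obtain a b where ab: "a \<in> carrier A" "b \<in> carrier A" "f a = f b" "y \<in> carrier A"
      "x = (y \<triangleleft>\<^bsub>A\<^esub> a) \<triangleleft>\<inverse>\<^bsub>A\<^esub> b" by auto
    have "x \<triangleleft>\<^bsub>A\<^esub> c = (y \<triangleleft>\<^bsub>A\<^esub> c) \<triangleleft>\<^bsub>A\<^esub> (a \<triangleleft>\<^bsub>A\<^esub> c) \<triangleleft>\<inverse>\<^bsub>A\<^esub> (b \<triangleleft>\<^bsub>A\<^esub> c)"
      using ab c A.self_distrib[of y a c] by (simp add: A.inv_act_act_distrib A.act_closed)
    also have "(\<dots>, y \<triangleleft>\<^bsub>A\<^esub> c) \<in> centralizing_rel A f"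
      using ab c by (intro centralizing_relI) (auto simp: A.act_closed rack_homD[OF f])
    finally show "(x \<triangleleft>\<^bsub>A\<^esub> c, y \<triangleleft>\<^bsub>A\<^esub> c) \<in> centralizing_rel A f" .
  qed (use c A.act_closed in auto)
  show "(x \<triangleleft>\<inverse>\<^bsub>A\<^esub> c, y \<triangleleft>\<inverse>\<^bsub>A\<^esub> c) \<in> centralizing_rel A f"
  proof (rule generated_equiv_map[where t = "\<lambda>x. x \<triangleleft>\<inverse>\<^bsub>A\<^esub> c",
        OF equiv_centralizing_rel[OF A] xy[unfolded centralizing_rel_def] _
          centralizing_pairs_subset[OF A]])
    fix x y assume "(x, y) \<in> centralizing_pairs A f"
    then obtain a b where ab: "a \<in> carrier A" "b \<in> carrier A" "f a = f b" "y \<in> carrier A"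
      "x = (y \<triangleleft>\<^bsub>A\<^esub> a) \<triangleleft>\<inverse>\<^bsub>A\<^esub> b" by auto
    have "x \<triangleleft>\<inverse>\<^bsub>A\<^esub> c = (y \<triangleleft>\<inverse>\<^bsub>A\<^esub> c) \<triangleleft>\<^bsub>A\<^esub> (a \<triangleleft>\<inverse>\<^bsub>A\<^esub> c) \<triangleleft>\<inverse>\<^bsub>A\<^esub> (b \<triangleleft>\<inverse>\<^bsub>A\<^esub> c)"
      using ab c A.inv_act_inv_act_distrib[of "y \<triangleleft>\<^bsub>A\<^esub> a" b c] A.act_inv_act_distrib[of y a c]
      by (simp add: A.act_closed)
    also have "(\<dots>, y \<triangleleft>\<inverse>\<^bsub>A\<^esub> c) \<in> centralizing_rel A f"
      using ab c by (intro centralizing_relI) (auto simp: A.inv_act_closed rack_homD[OF f])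
    finally show "(x \<triangleleft>\<inverse>\<^bsub>A\<^esub> c, y \<triangleleft>\<inverse>\<^bsub>A\<^esub> c) \<in> centralizing_rel A f" .
  qed (use c A.inv_act_closed in auto)
qed

text \<open>Apply the generating pair at \<open>x\<close> and cancel one of the two translations: by translating with \<open>d\<close>
  in the first case, and by starting at \<open>x \<triangleleft>\<inverse> d\<close> in the second.\<close>

lemma centralizing_rel_same_image:
  assumes A: "rack A" and f: "rack_hom A B f"
    and x: "x \<in> carrier A" and cd: "c \<in> carrier A" "d \<in> carrier A" "f c = f d"
  shows "(x \<triangleleft>\<^bsub>A\<^esub> c, x \<triangleleft>\<^bsub>A\<^esub> d) \<in> centralizing_rel A f"
    and "(x \<triangleleft>\<inverse>\<^bsub>A\<^esub> c, x \<triangleleft>\<inverse>\<^bsub>A\<^esub> d) \<in> centralizing_rel A f"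
proof -
  interpret A: rack A by (fact A)
  have "((x \<triangleleft>\<^bsub>A\<^esub> c) \<triangleleft>\<inverse>\<^bsub>A\<^esub> d \<triangleleft>\<^bsub>A\<^esub> d, x \<triangleleft>\<^bsub>A\<^esub> d) \<in> centralizing_rel A f"
    using centralizing_rel_translate(1)[OF A f] centralizing_relI x cd by metis
  then show "(x \<triangleleft>\<^bsub>A\<^esub> c, x \<triangleleft>\<^bsub>A\<^esub> d) \<in> centralizing_rel A f"
    using x cd by (simp add: A.inv_act_act A.act_closed)
  have "(((x \<triangleleft>\<inverse>\<^bsub>A\<^esub> d) \<triangleleft>\<^bsub>A\<^esub> d) \<triangleleft>\<inverse>\<^bsub>A\<^esub> c, x \<triangleleft>\<inverse>\<^bsub>A\<^esub> d) \<in> centralizing_rel A f"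
    using x cd by (intro centralizing_relI) (auto simp: A.inv_act_closed)
  then show "(x \<triangleleft>\<inverse>\<^bsub>A\<^esub> c, x \<triangleleft>\<inverse>\<^bsub>A\<^esub> d) \<in> centralizing_rel A f"
    using x cd by (simp add: A.inv_act_act)
qed

text \<open>Being a subrack of the square reduces to the two one-sided facts above: change the left operand
  first, then the right one.\<close>

lemma rack_centralizing_rack:
  assumes f: "extension A B f"
  shows "rack (centralizing_rack A f)"
proof -
  note f' = extensionD[OF f]
  let ?C = "centralizing_rel A f"
  have equiv: "equiv (carrier A) ?C" by (rule equiv_centralizing_rel[OF f'(1)])
  then have sub: "?C \<subseteq> carrier A \<times> carrier A" by (auto simp: equiv_def)
  have trans: "(u, w) \<in> ?C" if "(u, v) \<in> ?C" "(v, w) \<in> ?C" for u v w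
    using equiv that by (meson equiv_transD)
  note translate = centralizing_rel_translate[OF f'(1,3)]
    and same = centralizing_rel_same_image[OF f'(1,3)]
    and kernel = centralizing_rel_kernel[OF f'(1-3)]
  show ?thesis
    unfolding centralizing_rack_def
  proof (rule rack_subrack_prod[OF f'(1) f'(1) sub])
    fix x y c d assume xy: "(x, y) \<in> ?C" and cd: "(c, d) \<in> ?C"
    have mem: "y \<in> carrier A" "c \<in> carrier A" "d \<in> carrier A" using xy cd sub by auto
    show "(x \<triangleleft>\<^bsub>A\<^esub> c, y \<triangleleft>\<^bsub>A\<^esub> d) \<in> ?C"
      using trans translate(1)[OF mem(2) xy] same(1)[OF mem kernel[OF cd]] by blast
    show "(x \<triangleleft>\<inverse>\<^bsub>A\<^esub> c, y \<triangleleft>\<inverse>\<^bsub>A\<^esub> d) \<in> ?C"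
      using trans translate(2)[OF mem(2) xy] same(2)[OF mem kernel[OF cd]] by blast
  qed
qed

section \<open>Double extensions\<close>

locale double_ext =
  fixes A_top :: "'a rack_str" and A_bot :: "'b rack_str" and f_A :: "'a \<Rightarrow> 'b"
    and B_top :: "'c rack_str" and B_bot :: "'d rack_str" and f_B :: "'c \<Rightarrow> 'd"
    and \<alpha>_top :: "'a \<Rightarrow> 'c" and \<alpha>_bot :: "'b \<Rightarrow> 'd"
  assumes double: "double_extension A_top A_bot f_A B_top B_bot f_B \<alpha>_top \<alpha>_bot"
begin

lemma extensions:
  "extension A_top A_bot f_A" "extension B_top B_bot f_B" "extension A_top B_top \<alpha>_top"
  using double by (auto simp: double_extension_def)

lemma commutes: "x \<in> carrier A_top \<Longrightarrow> f_B (\<alpha>_top x) = \<alpha>_bot (f_A x)"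
  using double by (auto simp: double_extension_def)

text \<open>The comparison map to the pullback is onto: lift the first point arbitrarily, then lift the
  second one inside the fibre of \<open>f_A\<close> determined by this choice.\<close>

lemma lift_kernel_pair:
  assumes "a \<in> carrier B_top" "b \<in> carrier B_top" "f_B a = f_B b"
  obtains a' b' where "a' \<in> carrier A_top" "b' \<in> carrier A_top" "f_A a' = f_A b'"
    "\<alpha>_top a' = a" "\<alpha>_top b' = b"
proof -
  obtain a' where a': "a' \<in> carrier A_top" "\<alpha>_top a' = a"
    using extension_lift[OF extensions(3) assms(1)] .
  have "f_A a' \<in> carrier A_bot" 
    using rack_homD(1)[OF extensionD(3)[OF extensions(1)] a'(1)] .
  then have "(f_A a', b) \<in> carrier (pullback A_bot B_top \<alpha>_bot f_B)"
    using a' assms commutes[of a'] by (simp add: pullback_def)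
  then have "(f_A a', b) \<in> (\<lambda>x. (f_A x, \<alpha>_top x)) ` carrier A_top"
    using double by (simp add: double_extension_def)
  then show thesis using a' that by auto
qed

lemma centralizing_rel_map:
  assumes "(x, y) \<in> centralizing_rel A_top f_A"
  shows "(\<alpha>_top x, \<alpha>_top y) \<in> centralizing_rel B_top f_B"
proof -
  note A = extensionD[OF extensions(1)] and B = extensionD[OF extensions(2)]
    and \<alpha> = extensionD[OF extensions(3)]
  show ?thesis
  proof (rule generated_equiv_map[OF equiv_centralizing_rel[OF B(1)]
        assms[unfolded centralizing_rel_def] _ centralizing_pairs_subset[OF A(1)]])
    fix x y assume "(x, y) \<in> centralizing_pairs A_top f_A"
    then show "(\<alpha>_top x, \<alpha>_top y) \<in> centralizing_rel B_top f_B"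
      by (auto simp: rack_homD[OF \<alpha>(3)] rack.act_closed[OF A(1)] commutes
          intro!: centralizing_relI)
  qed (simp add: rack_homD[OF \<alpha>(3)])
qed

lemma centralizing_rel_lift:
  assumes uv: "(u, v) \<in> centralizing_rel B_top f_B" and x: "x \<in> carrier A_top" "\<alpha>_top x = u"
  shows "\<exists>y. \<alpha>_top y = v \<and> (x, y) \<in> centralizing_rel A_top f_A"
proof -
  note A = extensionD[OF extensions(1)] and B = extensionD[OF extensions(2)]
    and \<alpha> = extensionD[OF extensions(3)]
  interpret A: rack A_top by (fact A(1))
  interpret B: rack B_top by (fact B(1))
  have equiv: "equiv (carrier A_top) (centralizing_rel A_top f_A)"
    by (rule equiv_centralizing_rel[OF A(1)])
  show ?thesis
  proof (rule generated_equiv_lift[where t = \<alpha>_top, OF equiv uv[unfolded centralizing_rel_def] x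
        centralizing_pairs_subset[OF B(1)]])
    fix u v x assume "(u, v) \<in> centralizing_pairs B_top f_B" and x: "x \<in> carrier A_top"
    then obtain a b where v: "v \<in> carrier B_top" and ab: "a \<in> carrier B_top" "b \<in> carrier B_top"
      "f_B a = f_B b" and u: "u = (v \<triangleleft>\<^bsub>B_top\<^esub> a) \<triangleleft>\<inverse>\<^bsub>B_top\<^esub> b"
      by auto
    obtain a' b' where l: "a' \<in> carrier A_top" "b' \<in> carrier A_top" "f_A a' = f_A b'"
      "\<alpha>_top a' = a" "\<alpha>_top b' = b"
      using lift_kernel_pair[OF ab] .
    {
      assume "\<alpha>_top x = v"
      moreover have "(x, (x \<triangleleft>\<^bsub>A_top\<^esub> a') \<triangleleft>\<inverse>\<^bsub>A_top\<^esub> b') \<in> centralizing_rel A_top f_A"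
        using centralizing_relI[OF x l(1-3)] equiv by (meson equiv_symD)
      ultimately show "\<exists>y. \<alpha>_top y = u \<and> (x, y) \<in> centralizing_rel A_top f_A"
        using l x u
        by (intro exI[of _ "(x \<triangleleft>\<^bsub>A_top\<^esub> a') \<triangleleft>\<inverse>\<^bsub>A_top\<^esub> b'"])
          (auto simp: rack_homD[OF \<alpha>(3)] A.act_closed)
    }
    {
      assume "\<alpha>_top x = u"
      \<comment> \<open>The inverse of the translation by \<open>a\<close> followed by the inverse translation by \<open>b\<close>
        is of the same form, with \<open>a\<close> and \<open>b\<close> exchanged.\<close>
      let ?y = "(x \<triangleleft>\<^bsub>A_top\<^esub> b') \<triangleleft>\<inverse>\<^bsub>A_top\<^esub> a'"
      have "(x, ?y) \<in> centralizing_rel A_top f_A"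
        using centralizing_relI[OF x l(2,1) l(3)[symmetric]] equiv by (meson equiv_symD)
      moreover have "\<alpha>_top ?y = v"
        using l x u v ab \<open>\<alpha>_top x = u\<close>
        by (simp add: rack_homD[OF \<alpha>(3)] A.act_closed B.act_closed B.inv_act_act B.act_inv_act)
      ultimately show "\<exists>y. \<alpha>_top y = v \<and> (x, y) \<in> centralizing_rel A_top f_A" by blast
    }
  qed
qed

lemma extension_centralizing_rack:
  "extension (centralizing_rack A_top f_A) (centralizing_rack B_top f_B) (map_prod \<alpha>_top \<alpha>_top)"
proof -
  note A = extensionD[OF extensions(1)] and B = extensionD[OF extensions(2)]
    and \<alpha> = extensionD[OF extensions(3)]
  let ?CA = "centralizing_rel A_top f_A" and ?CB = "centralizing_rel B_top f_B"
  have sub: "x \<in> carrier A_top" "y \<in> carrier A_top" if "(x, y) \<in> ?CA" for x y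
    using that equiv_centralizing_rel[OF A(1), of f_A] by (auto simp: equiv_def)
  have subB: "?CB \<subseteq> carrier B_top \<times> carrier B_top"
    using equiv_centralizing_rel[OF B(1), of f_B] by (auto simp: equiv_def)
  have "rack_hom (centralizing_rack A_top f_A) (centralizing_rack B_top f_B)
      (map_prod \<alpha>_top \<alpha>_top)"
    by (auto simp: rack_hom_def centralizing_rack_def centralizing_rel_map
        intro!: rack_homD[OF \<alpha>(3)] intro: sub)
  moreover have "?CB \<subseteq> map_prod \<alpha>_top \<alpha>_top ` ?CA"
  proof
    fix p assume "p \<in> ?CB"
    moreover obtain u v where p: "p = (u, v)" by fastforce
    ultimately have uv: "(u, v) \<in> ?CB" and "u \<in> carrier B_top" using subB by auto
    then obtain x where x: "x \<in> carrier A_top" "\<alpha>_top x = u"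
      using extension_lift[OF extensions(3)] by blast
    then obtain y where "\<alpha>_top y = v" "(x, y) \<in> ?CA" using centralizing_rel_lift[OF uv x] by blast
    then show "p \<in> map_prod \<alpha>_top \<alpha>_top ` ?CA" using p x by force
  qed
  moreover have "map_prod \<alpha>_top \<alpha>_top ` ?CA \<subseteq> ?CB" using centralizing_rel_map by auto
  ultimately show ?thesis
    unfolding extension_def
    by (intro conjI equalityI rack_centralizing_rack[OF extensions(1)]
        rack_centralizing_rack[OF extensions(2)])
      (simp_all add: centralizing_rack_def)
qed

end

section \<open>Trivial extensions\<close>

lemma orbit_pairs_subset:
  "rack X \<Longrightarrow> {(x, x \<triangleleft>\<^bsub>X\<^esub> y) | x y. x \<in> carrier X \<and> y \<in> carrier X} \<subseteq> carrier X \<times> carrier X"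
  by (auto simp: rack.act_closed)

lemma equiv_orbit_rel: "rack X \<Longrightarrow> equiv (carrier X) (orbit_rel X)"
  unfolding orbit_rel_def by (intro equiv_generated_equiv orbit_pairs_subset)

lemma orbit_relI:
  assumes X: "rack X" and "x \<in> carrier X" "y \<in> carrier X"
  shows "(x, x \<triangleleft>\<^bsub>X\<^esub> y) \<in> orbit_rel X" "(x, x \<triangleleft>\<inverse>\<^bsub>X\<^esub> y) \<in> orbit_rel X"
proof -
  interpret rack X by (fact X)
  have *: "(x, x \<triangleleft>\<^bsub>X\<^esub> y) \<in> orbit_rel X" if "x \<in> carrier X" for x
  proof -
    have "(x, x \<triangleleft>\<^bsub>X\<^esub> y) \<in> {(x, x \<triangleleft>\<^bsub>X\<^esub> y) | x y. x \<in> carrier X \<and> y \<in> carrier X}"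
      using that assms(3) by blast
    then show ?thesis unfolding orbit_rel_def using generated_equiv_incl by (rule rev_subsetD)
  qed
  show "(x, x \<triangleleft>\<inverse>\<^bsub>X\<^esub> y) \<in> orbit_rel X"
    using *[of "x \<triangleleft>\<inverse>\<^bsub>X\<^esub> y"] assms equiv_orbit_rel[OF X]
    by (auto simp: inv_act_closed inv_act_act equiv_def dest: symD)
  show "(x, x \<triangleleft>\<^bsub>X\<^esub> y) \<in> orbit_rel X" by (rule *[OF assms(2)])
qed

lemma orbit_rel_invariant:
  assumes X: "rack X" and step: "\<And>x y. x \<in> carrier X \<Longrightarrow> y \<in> carrier X \<Longrightarrow> \<phi> (x \<triangleleft>\<^bsub>X\<^esub> y) = \<phi> x"
    and "(x, y) \<in> orbit_rel X"
  shows "\<phi> x = \<phi> y"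
proof -
  have "equiv UNIV Id" by (auto intro!: equivI refl_onI symI transI)
  then have "(\<phi> x, \<phi> y) \<in> Id"
    using assms(3) unfolding orbit_rel_def
    by (rule generated_equiv_map)
      (use step orbit_pairs_subset[OF X] in auto)
  then show ?thesis by simp
qed

lemma orbit_rel_map:
  assumes "rack X" "rack Y" "rack_hom X Y t" "(x, y) \<in> orbit_rel X"
  shows "(t x, t y) \<in> orbit_rel Y"
  using equiv_orbit_rel[OF assms(2)] assms(4) unfolding orbit_rel_def[of X]
  by (rule generated_equiv_map)
    (use assms rack.act_closed[OF assms(1)] in \<open>auto simp: rack_homD intro!: orbit_relI\<close>)

lemma orbit_rel_lift:
  assumes t: "extension X Y t" and uv: "(u, v) \<in> orbit_rel Y" and x: "x \<in> carrier X" "t x = u"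
  shows "\<exists>y. t y = v \<and> (x, y) \<in> orbit_rel X"
proof -
  note t' = extensionD[OF t]
  show ?thesis
  proof (rule generated_equiv_lift[where t = t, OF equiv_orbit_rel[OF t'(1)]
        uv[unfolded orbit_rel_def] x orbit_pairs_subset[OF t'(2)]])
    fix u v x assume "(u, v) \<in> {(x, x \<triangleleft>\<^bsub>Y\<^esub> y) | x y. x \<in> carrier Y \<and> y \<in> carrier Y}"
      and x: "x \<in> carrier X"
    then obtain b where u: "u \<in> carrier Y" and b: "b \<in> carrier Y" and v: "v = u \<triangleleft>\<^bsub>Y\<^esub> b" by auto
    obtain a where a: "a \<in> carrier X" "t a = b" using extension_lift[OF t b] .
    show "\<exists>y. t y = v \<and> (x, y) \<in> orbit_rel X" if "t x = u"
      using that x a v orbit_relI[OF t'(1) x a(1)]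
      by (intro exI[of _ "x \<triangleleft>\<^bsub>X\<^esub> a"]) (auto simp: rack_homD[OF t'(3)])
    show "\<exists>y. t y = u \<and> (x, y) \<in> orbit_rel X" if "t x = v"
      using that x a v u orbit_relI[OF t'(1) x a(1)]
      by (intro exI[of _ "x \<triangleleft>\<inverse>\<^bsub>X\<^esub> a"])
        (auto simp: rack_homD[OF t'(3)] rack.act_inv_act[OF t'(2)])
  qed
qed

text \<open>The comparison morphism from \<open>X\<close> to the pullback of the naturality square is onto for every
  extension, because chains in an orbit of \<open>Y\<close> lift to \<open>X\<close>. Hence only injectivity is at stake.\<close>

lemma trivial_extension_iff:
  assumes t: "extension X Y t"
  shows "trivial_extension X Y t \<longleftrightarrow> (\<forall>x y. (x, y) \<in> orbit_rel X \<longrightarrow> t x = t y \<longrightarrow> x = y)"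
proof -
  note t' = extensionD[OF t]
  interpret X: rack X by (fact t'(1))
  interpret Y: rack Y by (fact t'(2))
  let ?P = "pullback Y (pi0 X) (pi0_unit Y) (pi0_map Y t)"
  let ?h = "\<lambda>x. (t x, pi0_unit X x)"
  have eqX: "equiv (carrier X) (orbit_rel X)" and eqY: "equiv (carrier Y) (orbit_rel Y)"
    by (rule equiv_orbit_rel, fact t'(1), rule equiv_orbit_rel, fact t'(2))
  have unit_eq: "pi0_unit X x = pi0_unit X y \<longleftrightarrow> (x, y) \<in> orbit_rel X"
    if "x \<in> carrier X" "y \<in> carrier X" for x y
    unfolding pi0_unit_def using eq_equiv_class_iff[OF eqX that] .
  have map_unit: "pi0_map Y t (pi0_unit X x) = pi0_unit Y (t x)" if x: "x \<in> carrier X" for x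
  proof -
    have "orbit_rel Y `` {t y} = orbit_rel Y `` {t x}" if "(x, y) \<in> orbit_rel X" for y
      using orbit_rel_map[OF t'(1-3) that] equiv_class_eq[OF eqY] by metis
    moreover have "(x, x) \<in> orbit_rel X" using eqX x by (auto simp: equiv_def refl_on_def)
    ultimately show ?thesis unfolding pi0_map_def pi0_unit_def by blast
  qed
  have carrier_P: "(y, c) \<in> carrier ?P \<longleftrightarrow>
      y \<in> carrier Y \<and> c \<in> carrier X // orbit_rel X \<and> pi0_unit Y y = pi0_map Y t c" for y c
    by (simp add: pullback_def pi0_def trivial_rack_def)
  have h_mem: "?h x \<in> carrier ?P" if "x \<in> carrier X" for x
    using that map_unit carrier_P rack_homD(1)[OF t'(3)]
    by (auto simp: pi0_unit_def intro: quotientI)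
  have "rack_hom X ?P ?h"
    unfolding rack_hom_def
  proof (intro conjI ballI)
    fix x y assume xy: "x \<in> carrier X" "y \<in> carrier X"
    have "pi0_unit X (x \<triangleleft>\<^bsub>X\<^esub> y) = pi0_unit X x" "pi0_unit X (x \<triangleleft>\<inverse>\<^bsub>X\<^esub> y) = pi0_unit X x"
      using orbit_relI[OF t'(1) xy] xy unit_eq X.act_closed X.inv_act_closed by metis+
    then show "?h (x \<triangleleft>\<^bsub>X\<^esub> y) = ?h x \<triangleleft>\<^bsub>?P\<^esub> ?h y" "?h (x \<triangleleft>\<inverse>\<^bsub>X\<^esub> y) = ?h x \<triangleleft>\<inverse>\<^bsub>?P\<^esub> ?h y"
      using xy by (simp_all add: rack_homD[OF t'(3)] pullback_def pi0_def trivial_rack_def)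
  qed (rule h_mem)
  moreover have "?h ` carrier X = carrier ?P"
  proof (intro equalityI subsetI)
    fix p assume p: "p \<in> carrier ?P"
    obtain y c where yc: "p = (y, c)" by fastforce
    then have y: "y \<in> carrier Y" and c: "c \<in> carrier X // orbit_rel X"
      and e: "pi0_unit Y y = pi0_map Y t c"
      using p carrier_P by auto
    obtain x where x: "x \<in> carrier X" "c = pi0_unit X x"
      using c by (auto simp: pi0_unit_def elim: quotientE)
    have "pi0_unit Y (t x) = pi0_unit Y y" using e x map_unit by simp
    moreover have "t x \<in> carrier Y" using x rack_homD(1)[OF t'(3)] by blast
    ultimately have "(t x, y) \<in> orbit_rel Y"
      using y eq_equiv_class_iff[OF eqY] by (auto simp: pi0_unit_def)
    then obtain x' where x': "t x' = y" "(x, x') \<in> orbit_rel X"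
      using orbit_rel_lift[OF t _ x(1) refl] by blast
    then have "x' \<in> carrier X" using eqX by (auto simp: equiv_def)
    then show "p \<in> ?h ` carrier X" using x x' yc unit_eq by auto
  qed (use h_mem in blast)
  moreover have "inj_on ?h (carrier X) \<longleftrightarrow> (\<forall>x y. (x, y) \<in> orbit_rel X \<longrightarrow> t x = t y \<longrightarrow> x = y)"
  proof -
    have "x \<in> carrier X \<and> y \<in> carrier X" if "(x, y) \<in> orbit_rel X" for x y
      using eqX that by (auto simp: equiv_def)
    then show ?thesis unfolding inj_on_def using unit_eq by auto
  qed
  ultimately show ?thesis
    using t by (simp add: trivial_extension_def rack_iso_def bij_betw_def)
qed

section \<open>Central extensions\<close>

text \<open>The equational form of centrality: translations factor through \<open>f\<close>.\<close>

definition acts_through :: "'a rack_str \<Rightarrow> ('a \<Rightarrow> 'b) \<Rightarrow> bool" where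
  "acts_through A f \<longleftrightarrow> (\<forall>x\<in>carrier A. \<forall>a\<in>carrier A. \<forall>b\<in>carrier A.
     f a = f b \<longrightarrow> (x \<triangleleft>\<^bsub>A\<^esub> a) \<triangleleft>\<inverse>\<^bsub>A\<^esub> b = x)"

text \<open>In the pullback, moving \<open>(d, x)\<close> by \<open>(e, a)\<close> and back by \<open>(e, b)\<close> stays in the same orbit and
  in the same fibre, so a trivial pullback forces the point not to move.\<close>

lemma central_extension_acts_through:
  fixes K :: "'e rack_str \<Rightarrow> bool"
  assumes "central_extension K A B f"
  shows "acts_through A f"
  unfolding acts_through_def
proof (intro ballI impI)
  from assms obtain E :: "'e rack_str" and p where f: "extension A B f" and p: "extension E B p"
    and triv: "trivial_extension (pullback E A p f) E fst"
    unfolding central_extension_def by blast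
  note f' = extensionD[OF f] and p' = extensionD[OF p]
  let ?P = "pullback E A p f"
  interpret A: rack A by (fact f'(1))
  interpret E: rack E by (fact p'(1))
  interpret P: rack ?P by (rule rack_pullback[OF p'(1) f'(1) p'(3) f'(3)])
  fix x a b assume x: "x \<in> carrier A" and ab: "a \<in> carrier A" "b \<in> carrier A" "f a = f b"
  obtain d where d: "d \<in> carrier E" "p d = f x"
    using extension_lift[OF p] rack_homD(1)[OF f'(3) x] by metis
  obtain e where e: "e \<in> carrier E" "p e = f a"
    using extension_lift[OF p] rack_homD(1)[OF f'(3) ab(1)] by metis
  have mem: "(d, x) \<in> carrier ?P" "(e, a) \<in> carrier ?P" "(e, b) \<in> carrier ?P"
    using d e x ab by (auto simp: pullback_def)
  let ?y = "((d, x) \<triangleleft>\<^bsub>?P\<^esub> (e, a)) \<triangleleft>\<inverse>\<^bsub>?P\<^esub> (e, b)"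
  have "equiv (carrier ?P) (orbit_rel ?P)" by (rule equiv_orbit_rel[OF P.rack_axioms])
  then have "((d, x), ?y) \<in> orbit_rel ?P"
    using orbit_relI(1)[OF P.rack_axioms mem(1,2)]
      orbit_relI(2)[OF P.rack_axioms P.act_closed[OF mem(1,2)] mem(3)]
    by (meson equiv_transD)
  moreover have y: "?y = (d, (x \<triangleleft>\<^bsub>A\<^esub> a) \<triangleleft>\<inverse>\<^bsub>A\<^esub> b)"
    using d e by (simp add: pullback_def E.act_inv_act)
  ultimately show "(x \<triangleleft>\<^bsub>A\<^esub> a) \<triangleleft>\<inverse>\<^bsub>A\<^esub> b = x"
    using triv trivial_extension_iff[OF extension_pullback_fst[OF p f]] by fastforce
qed

lemma (in double_ext) acts_through_image:
  assumes "acts_through A_top f_A"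
  shows "acts_through B_top f_B"
  unfolding acts_through_def
proof (intro ballI impI)
  note \<alpha> = extensionD[OF extensions(3)]
  interpret A: rack A_top by (fact \<alpha>(1))
  fix x a b assume x: "x \<in> carrier B_top" and ab: "a \<in> carrier B_top" "b \<in> carrier B_top"
    "f_B a = f_B b"
  obtain x' where x': "x' \<in> carrier A_top" "\<alpha>_top x' = x" using extension_lift[OF extensions(3) x] .
  obtain a' b' where l: "a' \<in> carrier A_top" "b' \<in> carrier A_top" "f_A a' = f_A b'"
    "\<alpha>_top a' = a" "\<alpha>_top b' = b"
    using lift_kernel_pair[OF ab] .
  have "(x' \<triangleleft>\<^bsub>A_top\<^esub> a') \<triangleleft>\<inverse>\<^bsub>A_top\<^esub> b' = x'" using assms x' l by (simp add: acts_through_def)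
  then have "\<alpha>_top ((x' \<triangleleft>\<^bsub>A_top\<^esub> a') \<triangleleft>\<inverse>\<^bsub>A_top\<^esub> b') = x" using x' by simp
  then show "(x \<triangleleft>\<^bsub>B_top\<^esub> a) \<triangleleft>\<inverse>\<^bsub>B_top\<^esub> b = x"
    using x' l by (simp add: rack_homD[OF \<alpha>(3)] A.act_closed)
qed

section \<open>A splitting extension\<close>

fun move :: "'a rack_str \<Rightarrow> 'a \<Rightarrow> 'a \<times> bool \<Rightarrow> 'a" where
  "move X x (a, \<epsilon>) = (if \<epsilon> then x \<triangleleft>\<^bsub>X\<^esub> a else x \<triangleleft>\<inverse>\<^bsub>X\<^esub> a)"

definition walk :: "'a rack_str \<Rightarrow> 'a \<Rightarrow> ('a \<times> bool) list \<Rightarrow> 'a" where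
  "walk X = foldl (move X)"

lemma walk_simps [simp]:
  "walk X x [] = x" "walk X x (w @ [l]) = move X (walk X x w) l"
  by (simp_all add: walk_def)

text \<open>Choosing preimages under \<open>f\<close> turns a letter over \<open>B\<close> into a translation of \<open>A\<close>, which by the
  equational condition does not depend on the choice.\<close>

locale central_action =
  fixes A :: "'a rack_str" and B :: "'b rack_str" and f :: "'a \<Rightarrow> 'b"
  assumes ext: "extension A B f" and acts: "acts_through A f"
begin

sublocale A: rack A by (rule extensionD(1)[OF ext])
sublocale B: rack B by (rule extensionD(2)[OF ext])

lemma hom: "rack_hom A B f"
  by (rule extensionD(3)[OF ext])

lemma act_eq:
  assumes "x \<in> carrier A" "a \<in> carrier A" "b \<in> carrier A" "f a = f b"
  shows "x \<triangleleft>\<^bsub>A\<^esub> a = x \<triangleleft>\<^bsub>A\<^esub> b"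
proof -
  have "(x \<triangleleft>\<^bsub>A\<^esub> a) \<triangleleft>\<inverse>\<^bsub>A\<^esub> b = x" using acts assms by (simp add: acts_through_def)
  then show ?thesis using A.inv_act_act[of "x \<triangleleft>\<^bsub>A\<^esub> a" b] assms by (simp add: A.act_closed)
qed

definition sec :: "'b \<Rightarrow> 'a" where
  "sec = inv_into (carrier A) f"

lemma sec: "b \<in> carrier B \<Longrightarrow> sec b \<in> carrier A" "b \<in> carrier B \<Longrightarrow> f (sec b) = b"
  using extensionD(4)[OF ext] by (auto simp: sec_def inv_into_into f_inv_into_f)

definition transport :: "'a \<Rightarrow> ('b \<times> bool) list \<Rightarrow> 'a" where
  "transport x w = walk A x (map (apfst sec) w)"

lemma transport_simps [simp]:
  "transport x [] = x"
  "transport x (w @ [(b, \<epsilon>)]) = move A (transport x w) (sec b, \<epsilon>)"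
  by (simp_all add: transport_def del: move.simps)

definition fibre :: "'b \<Rightarrow> 'a set" where
  "fibre s = {x \<in> carrier A. f x = s}"

lemma fibre_nonempty: "s \<in> carrier B \<Longrightarrow> sec s \<in> fibre s"
  by (simp add: fibre_def sec)

definition path_words :: "('b \<times> bool) list set" where
  "path_words = lists (carrier B \<times> UNIV)"

lemma path_words_simps [simp]:
  "[] \<in> path_words"
  "w @ [(b, \<epsilon>)] \<in> path_words \<longleftrightarrow> w \<in> path_words \<and> b \<in> carrier B"
  by (auto simp: path_words_def)

lemma transport_closed:
  assumes "w \<in> path_words" "x \<in> fibre s"
  shows "transport x w \<in> carrier A" "f (transport x w) = walk B s w"
proof -
  have "transport x w \<in> carrier A \<and> f (transport x w) = walk B s w"
    using assms
    by (induction w rule: rev_induct)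
      (auto simp: fibre_def sec A.act_closed A.inv_act_closed rack_homD[OF hom])
  then show "transport x w \<in> carrier A" "f (transport x w) = walk B s w" by auto
qed

lemma transport_surj:
  assumes "w \<in> path_words" "s \<in> carrier B" "x \<in> fibre (walk B s w)"
  shows "\<exists>y\<in>fibre s. transport y w = x"
  using assms
proof (induction w arbitrary: x rule: rev_induct)
  case Nil
  then show ?case by simp
next
  case (snoc l w)
  obtain b \<epsilon> where l: "l = (b, \<epsilon>)" by fastforce
  have b: "b \<in> carrier B" and w: "w \<in> path_words" using snoc.prems l by auto
  have wB: "walk B s w \<in> carrier B"
    using rack_homD(1)[OF hom transport_closed(1)[OF w fibre_nonempty[OF snoc.prems(2)]]]
      transport_closed(2)[OF w fibre_nonempty[OF snoc.prems(2)]] by simp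
  let ?x = "move A x (sec b, \<not> \<epsilon>)"
  have "?x \<in> fibre (walk B s w)"
    using snoc.prems(3) b wB l
    by (auto simp: fibre_def sec A.act_closed A.inv_act_closed rack_homD[OF hom]
        B.act_inv_act B.inv_act_act)
  then obtain y where "y \<in> fibre s" "transport y w = ?x"
    using snoc.IH[OF w snoc.prems(2)] by blast
  then show ?case
    using l snoc.prems(3) b
    by (intro bexI[of _ y]) (auto simp: fibre_def sec A.act_inv_act A.inv_act_act)
qed

text \<open>A chosen representative of the class of words that transport the fibre over \<open>s\<close> as \<open>w\<close> does. It
  serves to name the elements of a quotient of the free rack by words.\<close>

definition canon :: "'b \<Rightarrow> ('b \<times> bool) list \<Rightarrow> ('b \<times> bool) list" where
  "canon s w = (SOME v. v \<in> path_words \<and> (\<forall>x\<in>fibre s. transport x v = transport x w))"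

lemma canon:
  assumes "w \<in> path_words"
  shows "canon s w \<in> path_words" "x \<in> fibre s \<Longrightarrow> transport x (canon s w) = transport x w"
proof -
  have "\<exists>v. v \<in> path_words \<and> (\<forall>x\<in>fibre s. transport x v = transport x w)" using assms by blast
  from someI_ex[OF this] show "canon s w \<in> path_words"
    "x \<in> fibre s \<Longrightarrow> transport x (canon s w) = transport x w"
    unfolding canon_def by auto
qed

lemma canon_cong:
  assumes "\<And>x. x \<in> fibre s \<Longrightarrow> transport x v = transport x w"
  shows "canon s v = canon s w"
  unfolding canon_def using assms by simp

lemma canon_canon: "w \<in> path_words \<Longrightarrow> canon s (canon s w) = canon s w"
  by (rule canon_cong) (rule canon)

definition endpoint :: "'b free_rack_elt \<Rightarrow> 'b" where
  "endpoint e = walk B (fst e) (snd e)"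

definition extend :: "'b free_rack_elt \<Rightarrow> 'b \<times> bool \<Rightarrow> 'b free_rack_elt" where
  "extend e l = (fst e, canon (fst e) (snd e @ [l]))"

text \<open>In the free rack, an element \<open>(t, h)\<close> acts on \<open>(s, w)\<close> by appending the conjugate of the letter
  \<open>t\<close> by \<open>h\<close> to \<open>w\<close>. On \<open>A\<close> this conjugate acts as the single letter \<open>t \<cdot> h\<close>, the endpoint of
  \<open>(t, h)\<close>, so in the quotient it is enough to append that letter.\<close>

definition path_rack :: "'b free_rack_elt rack_str" where
  "path_rack =
     \<lparr>carrier = {(s, w). s \<in> carrier B \<and> w \<in> path_words \<and> canon s w = w},
      act = (\<lambda>e e'. extend e (endpoint e', True)),
      inv_act = (\<lambda>e e'. extend e (endpoint e', False))\<rparr>"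

lemma path_rack_sel [simp]:
  "e \<triangleleft>\<^bsub>path_rack\<^esub> e' = extend e (endpoint e', True)"
  "e \<triangleleft>\<inverse>\<^bsub>path_rack\<^esub> e' = extend e (endpoint e', False)"
  by (simp_all add: path_rack_def)

lemma fst_extend [simp]: "fst (extend e l) = fst e"
  by (simp add: extend_def)

lemma extend_closed:
  assumes "e \<in> carrier path_rack" "b \<in> carrier B"
  shows "extend e (b, \<epsilon>) \<in> carrier path_rack"
  using assms by (auto simp: path_rack_def extend_def canon canon_canon)

lemma transport_extend:
  assumes "e \<in> carrier path_rack" "b \<in> carrier B" "x \<in> fibre (fst e)"
  shows "transport x (snd (extend e (b, \<epsilon>))) = move A (transport x (snd e)) (sec b, \<epsilon>)"
  using assms by (auto simp: path_rack_def extend_def canon simp del: move.simps)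

lemma transport_mem:
  assumes "e \<in> carrier path_rack" "x \<in> fibre (fst e)"
  shows "transport x (snd e) \<in> carrier A" "f (transport x (snd e)) = endpoint e"
  using assms transport_closed by (auto simp: path_rack_def endpoint_def)

lemma fibre_start:
  assumes "e \<in> carrier path_rack"
  obtains x where "x \<in> fibre (fst e)"
proof -
  have "fst e \<in> carrier B" using assms by (auto simp: path_rack_def)
  then show thesis using fibre_nonempty that by blast
qed

lemma endpoint_closed:
  assumes "e \<in> carrier path_rack"
  shows "endpoint e \<in> carrier B"
proof -
  obtain x where "x \<in> fibre (fst e)" using fibre_start[OF assms] .
  from transport_mem[OF assms this] rack_homD(1)[OF hom] show ?thesis by metis
qed

lemma path_rack_eqI:
  assumes "e \<in> carrier path_rack" "e' \<in> carrier path_rack" "fst e = fst e'"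
    and "\<And>x. x \<in> fibre (fst e) \<Longrightarrow> transport x (snd e) = transport x (snd e')"
  shows "e = e'"
  using assms canon_cong[of "fst e" "snd e" "snd e'"] by (auto simp: path_rack_def)

lemma endpoint_extend:
  assumes e: "e \<in> carrier path_rack" and b: "b \<in> carrier B"
  shows "endpoint (extend e (b, \<epsilon>)) = move B (endpoint e) (b, \<epsilon>)"
proof -
  obtain x where x: "x \<in> fibre (fst e)" using fibre_start[OF e] .
  have "endpoint (extend e (b, \<epsilon>)) = f (transport x (snd (extend e (b, \<epsilon>))))"
    using transport_mem(2)[OF extend_closed[OF e b]] x by simp
  also have "\<dots> = move B (endpoint e) (b, \<epsilon>)"
    using transport_mem[OF e x] b by (simp add: transport_extend[OF e b x] sec rack_homD[OF hom])
  finally show ?thesis .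
qed

text \<open>Elements with equal starting point are compared by their transports, so the axioms of \<open>A\<close> carry
  over. For self-distributivity, the chosen preimage of the endpoint of \<open>d \<triangleleft> c\<close> need not be the
  product of the preimages for \<open>d\<close> and \<open>c\<close>, but the two act alike, having the same image
  under \<open>f\<close>.\<close>

lemma rack_path_rack: "rack path_rack"
proof
  fix e d assume e: "e \<in> carrier path_rack" and d: "d \<in> carrier path_rack"
  note closed = extend_closed endpoint_closed[OF d] endpoint_closed[OF e]
  show "e \<triangleleft>\<^bsub>path_rack\<^esub> d \<in> carrier path_rack" "e \<triangleleft>\<inverse>\<^bsub>path_rack\<^esub> d \<in> carrier path_rack"
    using e closed by simp_all
  show "e \<triangleleft>\<^bsub>path_rack\<^esub> d \<triangleleft>\<inverse>\<^bsub>path_rack\<^esub> d = e"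
    using e closed
    by (intro path_rack_eqI)
      (auto simp: transport_extend transport_mem sec A.act_inv_act)
  show "e \<triangleleft>\<inverse>\<^bsub>path_rack\<^esub> d \<triangleleft>\<^bsub>path_rack\<^esub> d = e"
    using e closed
    by (intro path_rack_eqI)
      (auto simp: transport_extend transport_mem sec A.inv_act_act)
next
  fix e d c assume e: "e \<in> carrier path_rack" and d: "d \<in> carrier path_rack"
    and c: "c \<in> carrier path_rack"
  let ?d = "sec (endpoint d)" and ?c = "sec (endpoint c)"
  note ends = endpoint_closed[OF d] endpoint_closed[OF c]
  have dc: "endpoint (d \<triangleleft>\<^bsub>path_rack\<^esub> c) = endpoint d \<triangleleft>\<^bsub>B\<^esub> endpoint c"
    using d ends by (simp add: endpoint_extend)
  have "transport x (snd (e \<triangleleft>\<^bsub>path_rack\<^esub> d \<triangleleft>\<^bsub>path_rack\<^esub> c)) =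
      transport x (snd (e \<triangleleft>\<^bsub>path_rack\<^esub> c \<triangleleft>\<^bsub>path_rack\<^esub> (d \<triangleleft>\<^bsub>path_rack\<^esub> c)))"
    if x: "x \<in> fibre (fst e)" for x
  proof -
    let ?y = "transport x (snd e)"
    have y: "?y \<in> carrier A" by (rule transport_mem(1)[OF e x])
    have "transport x (snd (e \<triangleleft>\<^bsub>path_rack\<^esub> d \<triangleleft>\<^bsub>path_rack\<^esub> c)) = ?y \<triangleleft>\<^bsub>A\<^esub> ?d \<triangleleft>\<^bsub>A\<^esub> ?c"
      using e x ends by (simp add: transport_extend extend_closed)
    also have "\<dots> = (?y \<triangleleft>\<^bsub>A\<^esub> ?c) \<triangleleft>\<^bsub>A\<^esub> (?d \<triangleleft>\<^bsub>A\<^esub> ?c)"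
      using y ends by (simp add: A.self_distrib sec)
    also have "\<dots> = (?y \<triangleleft>\<^bsub>A\<^esub> ?c) \<triangleleft>\<^bsub>A\<^esub> sec (endpoint d \<triangleleft>\<^bsub>B\<^esub> endpoint c)"
      using y ends by (intro act_eq) (auto simp: A.act_closed B.act_closed sec rack_homD[OF hom])
    also have "\<dots> = transport x (snd (e \<triangleleft>\<^bsub>path_rack\<^esub> c \<triangleleft>\<^bsub>path_rack\<^esub> (d \<triangleleft>\<^bsub>path_rack\<^esub> c)))"
      using e x ends dc by (simp add: transport_extend extend_closed B.act_closed)
    finally show ?thesis .
  qed
  then show "e \<triangleleft>\<^bsub>path_rack\<^esub> d \<triangleleft>\<^bsub>path_rack\<^esub> c =
      e \<triangleleft>\<^bsub>path_rack\<^esub> c \<triangleleft>\<^bsub>path_rack\<^esub> (d \<triangleleft>\<^bsub>path_rack\<^esub> c)"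
    using e d c ends dc by (intro path_rack_eqI) (auto simp: extend_closed B.act_closed)
qed

text \<open>The chosen preimage of the endpoint of \<open>e\<close> acts on a transported point \<open>y\<close> just as \<open>y\<close> itself,
  because \<open>y\<close> lies over that endpoint too; and \<open>y\<close> fixes itself.\<close>

lemma quandle_path_rack:
  assumes "quandle A"
  shows "quandle path_rack"
proof -
  interpret quandle A by (fact assms)
  interpret P: rack path_rack by (rule rack_path_rack)
  show ?thesis
  proof
    fix e assume e: "e \<in> carrier path_rack"
    note end_B = endpoint_closed[OF e]
    show "e \<triangleleft>\<^bsub>path_rack\<^esub> e = e"
    proof (rule path_rack_eqI)
      fix x assume "x \<in> fibre (fst (e \<triangleleft>\<^bsub>path_rack\<^esub> e))"
      then have x: "x \<in> fibre (fst e)" by simp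
      let ?y = "transport x (snd e)"
      have y: "?y \<in> carrier A" "f ?y = endpoint e" using transport_mem[OF e x] .
      have "transport x (snd (e \<triangleleft>\<^bsub>path_rack\<^esub> e)) = ?y \<triangleleft>\<^bsub>A\<^esub> sec (endpoint e)"
        using e x end_B by (simp add: transport_extend)
      also have "\<dots> = ?y \<triangleleft>\<^bsub>A\<^esub> ?y" using y end_B by (intro act_eq) (auto simp: sec)
      also have "\<dots> = ?y" by (rule idem[OF y(1)])
      finally show "transport x (snd (e \<triangleleft>\<^bsub>path_rack\<^esub> e)) = ?y" .
    qed (use e end_B in \<open>auto simp: extend_closed\<close>)
  qed
qed

lemma extension_endpoint: "extension path_rack B endpoint"
proof -
  have "rack_hom path_rack B endpoint"
    by (auto simp: rack_hom_def endpoint_closed endpoint_extend)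
  moreover have "carrier B \<subseteq> endpoint ` carrier path_rack"
  proof
    fix s assume s: "s \<in> carrier B"
    let ?e = "(s, canon s [])"
    have e: "?e \<in> carrier path_rack" using s by (simp add: path_rack_def canon canon_canon)
    have x: "sec s \<in> fibre (fst ?e)" using fibre_nonempty[OF s] by simp
    have "endpoint ?e = s"
      using transport_mem(2)[OF e x] canon(2)[of "[]" "sec s" s] x s by (simp add: sec)
    then show "s \<in> endpoint ` carrier path_rack" using e by force
  qed
  moreover have "endpoint ` carrier path_rack \<subseteq> carrier B" using endpoint_closed by auto
  ultimately show ?thesis
    unfolding extension_def by (intro conjI equalityI rack_path_rack B.rack_axioms)
qed

text \<open>Transporting \<open>x\<close> back along \<open>w\<close> gives an invariant of orbits: an element of the pullback
  appends to \<open>w\<close> the very letter by which it moves \<open>x\<close>.\<close>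

lemma trivial_extension_path_rack:
  "trivial_extension (pullback path_rack A endpoint f) path_rack fst"
proof -
  let ?P = "pullback path_rack A endpoint f"
  have P: "rack ?P"
    using rack_pullback rack_path_rack A.rack_axioms extensionD(3)[OF extension_endpoint] hom by blast
  have carrier_P: "(e, x) \<in> carrier ?P \<longleftrightarrow> e \<in> carrier path_rack \<and> x \<in> carrier A \<and> endpoint e = f x"
    for e x by (simp add: pullback_def)
  \<comment> \<open>A singleton for points of the pullback. Written as a set of solutions, its invariance
    follows from cancellation, without first choosing a point of the fibre.\<close>
  define origin where
    "origin = (\<lambda>(e :: 'b free_rack_elt, x). {y \<in> fibre (fst e). transport y (snd e) = x})"
  have origin_act: "origin (u \<triangleleft>\<^bsub>?P\<^esub> v) = origin u" if "u \<in> carrier ?P" "v \<in> carrier ?P" for u v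
  proof -
    obtain e x d a where uv: "u = (e, x)" "v = (d, a)" by fastforce
    have e: "e \<in> carrier path_rack" and x: "x \<in> carrier A"
      and d: "d \<in> carrier path_rack" and a: "a \<in> carrier A" "endpoint d = f a"
      using that uv carrier_P by auto
    note end_B = endpoint_closed[OF d]
    have xa: "x \<triangleleft>\<^bsub>A\<^esub> a = x \<triangleleft>\<^bsub>A\<^esub> sec (endpoint d)"
      using x a end_B by (intro act_eq) (auto simp: sec)
    have "transport y (snd (extend e (endpoint d, True))) = x \<triangleleft>\<^bsub>A\<^esub> a \<longleftrightarrow> transport y (snd e) = x"
      if y: "y \<in> fibre (fst e)" for y
      using A.act_right_cancel[OF transport_mem(1)[OF e y] x sec(1)[OF end_B]]
      by (auto simp: transport_extend[OF e end_B y] xa)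
    then show ?thesis using uv by (auto simp: origin_def pullback_def)
  qed
  have "x = y" if uv: "((e, x), (e, y)) \<in> orbit_rel ?P" for e x y
  proof -
    have "(e, x) \<in> carrier ?P" using equiv_orbit_rel[OF P] uv by (auto simp: equiv_def)
    then have e: "e \<in> carrier path_rack" and x: "x \<in> carrier A" "endpoint e = f x"
      using carrier_P by auto
    obtain s w where "e = (s, w)" "s \<in> carrier B" "w \<in> path_words" using e by (auto simp: path_rack_def)
    then obtain z where "z \<in> fibre (fst e)" "transport z (snd e) = x"
      using transport_surj[of w s x] x by (auto simp: fibre_def endpoint_def)
    moreover have "origin (e, x) = origin (e, y)"
      using orbit_rel_invariant[OF P origin_act uv] .
    ultimately show "x = y" by (auto simp: origin_def)
  qed
  then show ?thesis
    using trivial_extension_iff[OF extension_pullback_fst[OF extension_endpoint ext]] by auto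
qed

lemma central_extension_rack:
  "central_extension (rack :: 'b free_rack_elt rack_str \<Rightarrow> bool) A B f"
  using ext rack_path_rack extension_endpoint trivial_extension_path_rack
  by (auto simp: central_extension_def)

lemma central_extension_quandle:
  assumes "quandle A"
  shows "central_extension (quandle :: 'b free_rack_elt rack_str \<Rightarrow> bool) A B f"
  using ext quandle_path_rack[OF assms] extension_endpoint trivial_extension_path_rack
  by (auto simp: central_extension_def)

end

theorem proposition3p4p2p2:
  fixes A_top :: "'a rack_str" and A_bot :: "'b rack_str"
    and B_top :: "'c rack_str" and B_bot :: "'d rack_str"
    and f_A :: "'a \<Rightarrow> 'b" and f_B :: "'c \<Rightarrow> 'd"
    and \<alpha>_top :: "'a \<Rightarrow> 'c" and \<alpha>_bot :: "'b \<Rightarrow> 'd"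
  assumes "double_extension A_top A_bot f_A B_top B_bot f_B \<alpha>_top \<alpha>_bot"
  shows "extension (centralizing_rack A_top f_A) (centralizing_rack B_top f_B)
           (map_prod \<alpha>_top \<alpha>_top) \<and>
         (central_extension (rack :: 'e rack_str \<Rightarrow> bool) A_top A_bot f_A \<longrightarrow>
          central_extension (rack :: 'd free_rack_elt rack_str \<Rightarrow> bool) B_top B_bot f_B) \<and>
         (quandle A_top \<and> quandle A_bot \<and> quandle B_top \<and> quandle B_bot \<longrightarrow>
          central_extension (quandle :: 'e rack_str \<Rightarrow> bool) A_top A_bot f_A \<longrightarrow>
          central_extension (quandle :: 'd free_rack_elt rack_str \<Rightarrow> bool) B_top B_bot f_B)"
proof -
  interpret double_ext A_top A_bot f_A B_top B_bot f_B \<alpha>_top \<alpha>_bot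
    by unfold_locales (fact assms)
  \<comment> \<open>The hypothesis enters for racks and for quandles alike only through its equational form.\<close>
  have *: "central_action B_top B_bot f_B"
    if "central_extension K A_top A_bot f_A" for K :: "'e rack_str \<Rightarrow> bool"
    by unfold_locales
      (fact extensions(2), fact acts_through_image[OF central_extension_acts_through[OF that]])
  show ?thesis
  proof (intro conjI impI)
    show "extension (centralizing_rack A_top f_A) (centralizing_rack B_top f_B)
        (map_prod \<alpha>_top \<alpha>_top)"
      by (fact extension_centralizing_rack)
  next
    assume "central_extension (rack :: 'e rack_str \<Rightarrow> bool) A_top A_bot f_A"
    then show "central_extension (rack :: 'd free_rack_elt rack_str \<Rightarrow> bool) B_top B_bot f_B"
      by (intro central_action.central_extension_rack *)
  next
    assume "quandle A_top \<and> quandle A_bot \<and> quandle B_top \<and> quandle B_bot"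
      and "central_extension (quandle :: 'e rack_str \<Rightarrow> bool) A_top A_bot f_A"
    then show "central_extension (quandle :: 'd free_rack_elt rack_str \<Rightarrow> bool) B_top B_bot f_B"
      by (intro central_action.central_extension_quandle *) auto
  qed
qed

end
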